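(* Let $\alpha\in[g,G]$. For every irrational $x\in I_\alpha$ and every $n\in\mathbb N$ we have: (i) $$\min\left\{\frac{q_n(x;\alpha)}{q_{n+1}(x;\alpha)},\frac{q_n(x;\alpha)}{q_{n+2}(x;\alpha)},\frac{q_n(x;\alpha)}{q_{n+3}(x;\alpha)},\frac{q_n(x;\alpha)}{q_{n+4}(x;\alpha)},\frac{q_n(x;\alpha)}{q_{n+5}(x;\alpha)}\right\}\le\left(\frac1{5G-2}\right)^{1/5}.$$ (ii) $q_n(x;\alpha)\ge qB^n$, where $B=(5G-2)^{1/5}\approx1.43524>\sqrt2$ and $q=\left(\frac gB\right)^4\approx0.03438$.
   Context: $g=\frac12(\sqrt5-1)$, $G=\frac12(\sqrt5+1)$, $[\cdot]$ in the formula for $d_\alpha$ is the integer part (floor). $I_\alpha=[\alpha-2,\alpha)$. For $x\neq0$, $d_\alpha(x)=2\left[\frac1{2|x|}+\frac{1-\alpha}2\right]+1$; $\varphi_\alpha:I_\alpha\to I_\alpha$ is given by $\varphi_\alpha(0)=0$, $\varphi_\alpha(x)=\frac1{|x|}-d_\alpha(x)$ for $x\ne0$. For irrational $x\in I_\alpha$ put $d_i=d_\alpha(\varphi_\alpha^{i-1}(x))$ and $e_i=\operatorname{sign}(\varphi_\alpha^{i-1}(x))$, $i\ge1$. The denominators $q_n=q_n(x;\alpha)$ are defined by $q_{-1}=0$, $q_0=1$, $q_n=d_nq_{n-1}+e_nq_{n-2}$ for $n\ge1$. *)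

theory Defs
  imports Complex_Main
begin

definition golden_g :: real where
  "golden_g = (sqrt 5 - 1) / 2"

definition golden_G :: real where
  "golden_G = (sqrt 5 + 1) / 2"

definition rate_B :: real where
  "rate_B = root 5 (5 * golden_G - 2)"

definition const_q :: real where
  "const_q = (golden_g / rate_B) ^ 4"

definition ocf_interval :: "real \<Rightarrow> real set" where
  "ocf_interval \<alpha> = {\<alpha> - 2..<\<alpha>}"

text \<open>
  The digit is the odd integer \<open>d\<close> with \<open>1 / \<bar>x\<bar> - d\<close> in \<open>ocf_interval \<alpha>\<close>.
  It is only meaningful for nonzero \<open>x\<close>.
\<close>

definition ocf_digit :: "real \<Rightarrow> real \<Rightarrow> int" where
  "ocf_digit \<alpha> x = 2 * \<lfloor>1 / (2 * \<bar>x\<bar>) + (1 - \<alpha>) / 2\<rfloor> + 1"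

definition ocf_map :: "real \<Rightarrow> real \<Rightarrow> real" where
  "ocf_map \<alpha> x = (if x = 0 then 0 else 1 / \<bar>x\<bar> - of_int (ocf_digit \<alpha> x))"

text \<open>The sequences \<open>ocf_d\<close> and \<open>ocf_e\<close> are indexed from \<open>1\<close>; index \<open>0\<close> is never used.\<close>

definition ocf_d :: "real \<Rightarrow> real \<Rightarrow> nat \<Rightarrow> int" where
  "ocf_d \<alpha> x i = ocf_digit \<alpha> ((ocf_map \<alpha> ^^ (i - 1)) x)"

definition ocf_e :: "real \<Rightarrow> real \<Rightarrow> nat \<Rightarrow> real" where
  "ocf_e \<alpha> x i = sgn ((ocf_map \<alpha> ^^ (i - 1)) x)"

text \<open>
  The recurrence for the denominators starts at index \<open>-1\<close>, so it is defined with the index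
  shifted by one: \<open>ocf_q_shift \<alpha> x k\<close> is the denominator with index \<open>k - 1\<close>.
\<close>

fun ocf_q_shift :: "real \<Rightarrow> real \<Rightarrow> nat \<Rightarrow> real" where
  "ocf_q_shift \<alpha> x 0 = 0"
| "ocf_q_shift \<alpha> x (Suc 0) = 1"
| "ocf_q_shift \<alpha> x (Suc (Suc n)) =
     of_int (ocf_d \<alpha> x (Suc n)) * ocf_q_shift \<alpha> x (Suc n)
     + ocf_e \<alpha> x (Suc n) * ocf_q_shift \<alpha> x n"

definition ocf_q :: "real \<Rightarrow> real \<Rightarrow> nat \<Rightarrow> real" where
  "ocf_q \<alpha> x n = ocf_q_shift \<alpha> x (Suc n)"

end

theory Submission
  imports Defs
begin

text \<open>
  Write \<open>q\<^sub>n\<close> for the denominators. Although \<open>q\<^sub>n\<close> need not increase, there is always some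
  \<open>j \<in> {1..5}\<close> with \<open>q\<^bsub>n+j\<^esub> \<ge> B\<^sup>j q\<^sub>n\<close>. This is stronger than (i), and iterating it, with at most
  four leftover steps each losing a factor of at most \<open>g\<close>, gives (ii).

  To find \<open>j\<close>, one controls \<open>r = q\<^bsub>n-1\<^esub> / q\<^sub>n\<close> jointly with the position of the orbit: always
  \<open>0 \<le> r \<le> G\<close>; \<open>r > g\<^sup>2\<close> forces the orbit point to be at least \<open>- g\<^sup>2 = G - 2\<close>, which excludes
  the digit \<open>1\<close> with sign \<open>-1\<close>; and \<open>r > 1\<close> forces it to be at least \<open>- 1 / (3 + \<alpha>)\<close>, which also
  excludes the digit \<open>3\<close> with sign \<open>-1\<close>. The slowest growth therefore comes from sign \<open>-1\<close> and digit \<open>1\<close> with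
  \<open>r = g\<^sup>2\<close>, followed by four digits \<open>1\<close> with sign \<open>+1\<close>; then
  \<open>q\<^bsub>n+5\<^esub> = 8 q\<^sub>n - 5 q\<^bsub>n-1\<^esub> = (8 - 5 g\<^sup>2) q\<^sub>n = (5 G - 2) q\<^sub>n = B\<^sup>5 q\<^sub>n\<close>.
\<close>

section \<open>The constants\<close>

lemma golden_G_square: "golden_G * golden_G = golden_G + 1"
  by (simp add: golden_G_def field_simps)

lemma golden_g_eq: "golden_g = golden_G - 1"
  by (simp add: golden_G_def golden_g_def field_simps)

lemma golden_G_bounds: "1.618033988 < golden_G" "golden_G < 1.618033989"
proof -
  have "2.236067976 < sqrt 5"
    by (rule real_less_rsqrt) (simp add: power2_eq_square)
  moreover have "sqrt 5 < 2.236067978"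
    by (rule real_less_lsqrt) (simp_all add: power2_eq_square)
  ultimately show "1.618033988 < golden_G" "golden_G < 1.618033989"
    by (simp_all add: golden_G_def)
qed

lemma golden_G_coarse: "8 / 5 < golden_G" "golden_G < 81 / 50"
  using golden_G_bounds by simp_all

lemma rate_B_pow5: "rate_B ^ 5 = 5 * golden_G - 2"
  unfolding rate_B_def using golden_G_coarse by (intro real_root_pow_pos2) auto

lemma rate_B_nonneg: "0 \<le> rate_B"
  unfolding rate_B_def using golden_G_coarse by (intro real_root_ge_zero) auto

lemma rate_B_bounds: "1.435244 < rate_B" "rate_B < 1.435245"
proof -
  show "1.435244 < rate_B"
  proof (rule power_less_imp_less_base[OF _ rate_B_nonneg])
    show "1.435244 ^ 5 < rate_B ^ 5"
      unfolding rate_B_pow5 using golden_G_bounds by (simp add: eval_nat_numeral)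
  qed
  show "rate_B < 1.435245"
  proof (rule power_less_imp_less_base)
    show "rate_B ^ 5 < 1.435245 ^ 5"
      unfolding rate_B_pow5 using golden_G_bounds by (simp add: eval_nat_numeral)
  qed simp
qed

text \<open>Reduces the growth estimates over two, three and four steps to linear arithmetic. Five
  steps are the sharp case and use the exact value in \<open>rate_B_pow5\<close>.\<close>

lemma rate_B_pow_le:
  "rate_B ^ 2 \<le> 2.06" "rate_B ^ 3 \<le> 2.96" "rate_B ^ 4 \<le> 4.25"
proof -
  have *: "rate_B ^ n \<le> 1.435245 ^ n" for n
    using rate_B_bounds by (intro power_mono rate_B_nonneg) auto
  show "rate_B ^ 2 \<le> 2.06" "rate_B ^ 3 \<le> 2.96" "rate_B ^ 4 \<le> 4.25"
    using *[of 2] *[of 3] *[of 4] by (simp_all add: eval_nat_numeral)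
qed

lemma rate_B_gt_sqrt2: "sqrt 2 < rate_B"
proof -
  have "sqrt 2 < 1.435244"
    by (rule real_less_lsqrt) (simp_all add: power2_eq_square)
  then show ?thesis using rate_B_bounds by linarith
qed

lemma const_q_approx: "\<bar>const_q - 0.03438\<bar> \<le> 0.000005"
proof -
  have gpos: "0.618033988 \<le> golden_g" "golden_g \<le> 0.618033989"
    using golden_G_bounds by (simp_all add: golden_g_eq)
  have Bpos: "0 < rate_B" using rate_B_bounds by simp
  \<comment> \<open>A bracket of g / B narrow enough that its fourth powers stay within 0.000005 of
    0.03438.\<close>
  have "0.43061 * rate_B \<le> golden_g" "golden_g \<le> 0.430613 * rate_B"
    using gpos rate_B_bounds by simp_all
  then have "0.43061 \<le> golden_g / rate_B" "golden_g / rate_B \<le> 0.430613"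
    using Bpos by (simp_all add: field_simps)
  then have "0.43061 ^ 4 \<le> const_q" "const_q \<le> 0.430613 ^ 4"
    unfolding const_q_def using gpos Bpos by (auto intro!: power_mono)
  then show ?thesis by (simp add: eval_nat_numeral abs_le_iff)
qed

section \<open>One step of the expansion\<close>

lemma ocf_digit_bounds:
  "of_int (ocf_digit \<alpha> x) + \<alpha> - 2 \<le> 1 / \<bar>x\<bar>" "1 / \<bar>x\<bar> < of_int (ocf_digit \<alpha> x) + \<alpha>"
proof -
  define t where "t = 1 / (2 * \<bar>x\<bar>) + (1 - \<alpha>) / 2"
  have "1 / \<bar>x\<bar> = 2 * t - 1 + \<alpha>" by (simp add: t_def field_simps)
  moreover have "of_int \<lfloor>t\<rfloor> \<le> t" "t < of_int \<lfloor>t\<rfloor> + 1"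
    by linarith+
  moreover have "real_of_int (ocf_digit \<alpha> x) = 2 * of_int \<lfloor>t\<rfloor> + 1"
    by (simp add: ocf_digit_def t_def)
  ultimately show "of_int (ocf_digit \<alpha> x) + \<alpha> - 2 \<le> 1 / \<bar>x\<bar>"
    "1 / \<bar>x\<bar> < of_int (ocf_digit \<alpha> x) + \<alpha>" by linarith+
qed

lemma ocf_map_in_interval:
  assumes "x \<noteq> 0"
  shows "ocf_map \<alpha> x \<in> ocf_interval \<alpha>"
  using ocf_digit_bounds[where \<alpha> = \<alpha> and x = x] assms by (auto simp: ocf_map_def ocf_interval_def)

lemma ocf_map_irrational:
  assumes "x \<notin> \<rat>"
  shows "ocf_map \<alpha> x \<notin> \<rat>"
proof
  have "x \<noteq> 0" using assms by auto
  moreover assume "ocf_map \<alpha> x \<in> \<rat>"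
  ultimately have "ocf_map \<alpha> x + of_int (ocf_digit \<alpha> x) \<in> \<rat>" by simp
  then have "1 / \<bar>x\<bar> \<in> \<rat>" using \<open>x \<noteq> 0\<close> by (simp add: ocf_map_def)
  then have "1 / (1 / \<bar>x\<bar>) \<in> \<rat>" by (rule Rats_divide[OF Rats_1])
  then show False using assms by (auto simp: abs_if split: if_splits)
qed

lemma ocf_map_funpow_irrational:
  assumes "x \<notin> \<rat>"
  shows "(ocf_map \<alpha> ^^ n) x \<notin> \<rat>"
  by (induction n) (use assms ocf_map_irrational in auto)

lemma ocf_map_funpow_in_interval:
  assumes "x \<in> ocf_interval \<alpha>" "x \<notin> \<rat>"
  shows "(ocf_map \<alpha> ^^ n) x \<in> ocf_interval \<alpha>"
proof (cases n)
  case (Suc m)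
  have "(ocf_map \<alpha> ^^ m) x \<noteq> 0"
    using ocf_map_funpow_irrational[OF assms(2), where \<alpha> = \<alpha> and n = m] by auto
  then show ?thesis using Suc by (simp add: ocf_map_in_interval)
qed (use assms in simp)

text \<open>Since |x| <= G, the value 1 / |x| is at least 1 / G = g, while it is less than d +
  \<alpha> <= d + G. Hence d > g - G = -1, and d is odd.\<close>

lemma ocf_digit_cases:
  assumes "\<alpha> \<in> {golden_g..golden_G}" "x \<in> ocf_interval \<alpha>" "x \<noteq> 0"
  shows "ocf_digit \<alpha> x = 1 \<or> ocf_digit \<alpha> x = 3 \<or> 5 \<le> ocf_digit \<alpha> x"
proof -
  have bd: "\<alpha> - 2 \<le> x" "x < \<alpha>" using assms by (auto simp: ocf_interval_def)
  have ab: "\<alpha> \<le> golden_G" "golden_G - 1 \<le> \<alpha>" using assms by (auto simp: golden_g_eq)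
  have "x \<le> golden_G" using bd(2) ab(1) by linarith
  moreover have "- x \<le> golden_G" using bd(1) ab(2) golden_G_coarse(1) by linarith
  ultimately have "\<bar>x\<bar> \<le> golden_G" by (simp add: abs_le_iff)
  then have "1 / golden_G \<le> 1 / \<bar>x\<bar>" using assms golden_G_coarse by (intro divide_left_mono) auto
  moreover have "1 / golden_G = golden_G - 1"
    using golden_G_square golden_G_coarse by (simp add: field_simps)
  ultimately have "- 1 < real_of_int (ocf_digit \<alpha> x)"
    using ocf_digit_bounds(2)[where \<alpha> = \<alpha> and x = x] ab by linarith
  then have "- 1 < ocf_digit \<alpha> x" by linarith
  moreover have "odd (ocf_digit \<alpha> x)" by (simp add: ocf_digit_def)
  ultimately show ?thesis by presburger
qed

section \<open>The thresholds - g^2 and - 1 / (3 + \<alpha>) for orbit points\<close>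

lemma ocf_map_ge_pos_digit1:
  assumes "\<alpha> \<in> {golden_g..golden_G}" "x \<in> ocf_interval \<alpha>" "0 < x" "ocf_digit \<alpha> x = 1"
  shows "golden_G - 2 \<le> ocf_map \<alpha> x"
proof -
  have "x \<le> golden_G" using assms by (auto simp: ocf_interval_def)
  then have "1 / golden_G \<le> 1 / x" using assms golden_G_coarse by (intro divide_left_mono) auto
  moreover have "1 / golden_G = golden_G - 1"
    using golden_G_square golden_G_coarse by (simp add: field_simps)
  ultimately show ?thesis using assms by (simp add: ocf_map_def)
qed

text \<open>At x = - g^2 the value 1 / |x| is G + 1 >= 1 + \<alpha>, already beyond the range of
  digit 1, and it only increases towards 0.\<close>

lemma neg_digit1_less:
  assumes "\<alpha> \<in> {golden_g..golden_G}" "x < 0" "ocf_digit \<alpha> x = 1"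
  shows "x < golden_G - 2"
proof (rule ccontr)
  assume "\<not> ?thesis"
  then have "- x \<le> 2 - golden_G" by simp
  then have "1 / (2 - golden_G) \<le> 1 / (- x)"
    using assms golden_G_coarse by (intro divide_left_mono) (auto intro!: mult_pos_neg)
  moreover have "1 / (2 - golden_G) = golden_G + 1"
    using golden_G_square golden_G_coarse by (simp add: field_simps)
  ultimately show False using ocf_digit_bounds(2)[where \<alpha> = \<alpha> and x = x] assms by simp
qed

text \<open>Orders the two thresholds, so that lying above the second one rules out both digits 1
  and 3 with sign -1.\<close>

lemma neg_inverse_ge:
  assumes "\<alpha> \<in> {golden_g..golden_G}"
  shows "golden_G - 2 \<le> - 1 / (3 + \<alpha>)"
proof -
  have "1 / (3 + \<alpha>) \<le> 1 / (golden_G + 1)"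
    using assms golden_G_coarse by (intro divide_left_mono) (auto simp: golden_g_eq)
  moreover have "1 / (golden_G + 1) = 2 - golden_G"
    using golden_G_square golden_G_coarse by (simp add: field_simps)
  ultimately show ?thesis by simp
qed

text \<open>The extreme point is the left endpoint \<alpha> - 2. There the bound amounts to
  \<alpha>^2 + \<alpha> >= 1, which follows from \<alpha> >= g because g^2 + g = 1.\<close>

lemma ocf_map_ge_neg_digit1:
  assumes "\<alpha> \<in> {golden_g..golden_G}" "x \<in> ocf_interval \<alpha>" "x < 0" "ocf_digit \<alpha> x = 1"
  shows "- 1 / (3 + \<alpha>) \<le> ocf_map \<alpha> x"
proof -
  have ab: "\<alpha> \<le> golden_G" "golden_G - 1 \<le> \<alpha>" using assms by (auto simp: golden_g_eq)
  have "(golden_G - 1) * (golden_G - 1) \<le> \<alpha> * \<alpha>"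
    using ab golden_G_coarse by (intro mult_mono) auto
  then have "1 \<le> \<alpha> * \<alpha> + \<alpha>" using ab golden_G_square by (simp add: algebra_simps)
  moreover have pos: "0 < 2 - \<alpha>" "0 < 3 + \<alpha>" using ab golden_G_coarse by auto
  ultimately have "1 - 1 / (3 + \<alpha>) \<le> 1 / (2 - \<alpha>)" by (simp add: field_simps)
  also have "\<dots> \<le> 1 / \<bar>x\<bar>"
    using assms pos by (intro divide_left_mono) (auto simp: ocf_interval_def intro!: mult_pos_neg)
  finally show ?thesis using assms by (simp add: ocf_map_def)
qed

lemma neg_digit3_less:
  assumes "\<alpha> \<in> {golden_g..golden_G}" "x < 0" "ocf_digit \<alpha> x = 3"
  shows "x < - 1 / (3 + \<alpha>)"
proof -
  have "0 < 3 + \<alpha>" using assms golden_G_coarse by (auto simp: golden_g_eq)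
  moreover have "1 / (- x) < 3 + \<alpha>" using ocf_digit_bounds(2)[where \<alpha> = \<alpha> and x = x] assms by simp
  ultimately show ?thesis using assms(2) by (simp add: field_simps)
qed

text \<open>The point - g^2 is fixed by the branch 1 / |x| - 3, which is increasing for negative
  x.\<close>

lemma ocf_map_ge_neg_digit3:
  assumes "x < 0" "ocf_digit \<alpha> x = 3" "golden_G - 2 \<le> x"
  shows "golden_G - 2 \<le> ocf_map \<alpha> x"
proof -
  have "1 / (2 - golden_G) \<le> 1 / (- x)"
    using assms golden_G_coarse by (intro divide_left_mono) (auto intro!: mult_pos_neg)
  moreover have "1 / (2 - golden_G) = golden_G + 1"
    using golden_G_square golden_G_coarse by (simp add: field_simps)
  ultimately show ?thesis using assms by (simp add: ocf_map_def)
qed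

section \<open>Growth of the denominators\<close>

locale ocf_expansion =
  fixes \<alpha> x :: real
  assumes alpha: "\<alpha> \<in> {golden_g..golden_G}"
    and x_in: "x \<in> ocf_interval \<alpha>"
    and x_irrational: "x \<notin> \<rat>"
begin

declare ocf_q_shift.simps(3) [simp del]

text \<open>Index convention: \<open>h (Suc k)\<close> is the denominator q_k, and
  \<open>z k\<close> is the point whose sign and digit lead from q_k to q_(k+1).\<close>

abbreviation z :: "nat \<Rightarrow> real" where "z k \<equiv> (ocf_map \<alpha> ^^ k) x"

abbreviation h :: "nat \<Rightarrow> real" where "h \<equiv> ocf_q_shift \<alpha> x"

text \<open>Nonnegativity is a premise because the induction that proves positivity uses this split.
  It lets a large digit be replaced by 3 or 5, which leaves only an inequality.\<close>

lemma step_cases [consumes 1]: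
  assumes "0 \<le> h (Suc k)"
  obtains
    (pos1) "h (Suc (Suc k)) = h (Suc k) + h k" "golden_G - 2 \<le> z (Suc k)"
  | (neg1) "h (Suc (Suc k)) = h (Suc k) - h k" "z k < golden_G - 2"
      "- 1 / (3 + \<alpha>) \<le> z (Suc k)" "golden_G - 2 \<le> z (Suc k)"
  | (neg3) "h (Suc (Suc k)) = 3 * h (Suc k) - h k" "z k < - 1 / (3 + \<alpha>)"
      "golden_G - 2 \<le> z k \<longrightarrow> golden_G - 2 \<le> z (Suc k)"
  | (pos_ge3) "3 * h (Suc k) + h k \<le> h (Suc (Suc k))"
  | (neg_ge5) "5 * h (Suc k) - h k \<le> h (Suc (Suc k))"
proof -
  have irr: "z k \<notin> \<rat>" by (rule ocf_map_funpow_irrational[OF x_irrational])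
  then have nz: "z k \<noteq> 0" by auto
  have int: "z k \<in> ocf_interval \<alpha>" by (rule ocf_map_funpow_in_interval[OF x_in x_irrational])
  define d where "d = ocf_digit \<alpha> (z k)"
  have rec: "h (Suc (Suc k)) = of_int d * h (Suc k) + sgn (z k) * h k"
    by (simp add: ocf_d_def ocf_e_def d_def ocf_q_shift.simps(3))
  have d: "d = 1 \<or> d = 3 \<or> 5 \<le> d"
    unfolding d_def by (rule ocf_digit_cases[OF alpha int nz])
  have large: "of_int c * h (Suc k) \<le> of_int d * h (Suc k)" if "c \<le> d" for c
    using that assms by (intro mult_right_mono) auto
  show thesis
  proof (cases "z k > 0")
    case True
    show thesis
    proof (cases "d = 1")
      case d1: True
      show thesis
        using ocf_map_ge_pos_digit1[OF alpha int True] d1 rec True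
        by (intro pos1) (simp_all add: d_def)
    next
      case False
      then show thesis using large[of 3] d rec True by (intro pos_ge3) auto
    qed
  next
    case False
    then have neg: "z k < 0" using nz by simp
    show thesis
    proof (cases "d = 1")
      case d1: True
      have "- 1 / (3 + \<alpha>) \<le> z (Suc k)"
        using ocf_map_ge_neg_digit1[OF alpha int neg] d1 by (simp add: d_def)
      then show thesis
        using neg_digit1_less[OF alpha neg] neg_inverse_ge[OF alpha] d1 rec neg
        by (intro neg1) (simp_all add: d_def)
    next
      case nd1: False
      show thesis
      proof (cases "d = 3")
        case d3: True
        show thesis
          using neg_digit3_less[OF alpha neg] ocf_map_ge_neg_digit3[OF neg] d3 rec neg
          by (intro neg3) (simp_all add: d_def)
      next
        case False
        then show thesis using nd1 large[of 5] d rec neg by (intro neg_ge5) auto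
      qed
    qed
  qed
qed

text \<open>The bounds must be proved together. After digit 1 with sign -1, the first implication
  gives q - p >= g q, so the new ratio is at most G, and the new point lies above both thresholds.
  After digit 3 with sign -1, the second implication gives 3 q - p >= 2 q. After digit 1 with sign
  +1, the new ratio is at most 1 and the new point is at least - g^2.\<close>

lemma denominator_invariant:
  "0 < h (Suc k) \<and> 0 \<le> h k \<and> h k \<le> golden_G * h (Suc k)
   \<and> ((2 - golden_G) * h (Suc k) < h k \<longrightarrow> golden_G - 2 \<le> z k)
   \<and> (h (Suc k) < h k \<longrightarrow> - 1 / (3 + \<alpha>) \<le> z k)"
proof (induction k)
  case 0
  show ?case using golden_G_coarse by simp
next
  case (Suc k)
  define p q r where "p = h k" "q = h (Suc k)" "r = h (Suc (Suc k))"
  note pqr = p_q_r_def[symmetric]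
  have IH: "0 < q" "0 \<le> p" "p \<le> golden_G * q"
    "(2 - golden_G) * q < p \<Longrightarrow> golden_G - 2 \<le> z k" "q < p \<Longrightarrow> - 1 / (3 + \<alpha>) \<le> z k"
    using Suc.IH unfolding pqr by auto
  have q0: "0 \<le> h (Suc k)" using IH(1) by (simp add: p_q_r_def)
  have Gq: "golden_G * q \<le> 81 / 50 * q"
    using IH(1) golden_G_coarse by auto
  \<comment> \<open>The new ratio is at most 1/3 < 2 - G, so both implications hold
    vacuously.\<close>
  have small: ?case if "3 * q \<le> r"
  proof -
    have "0 < r" using that IH by linarith
    have "1 / 3 * r \<le> (2 - golden_G) * r" "1 * r \<le> golden_G * r"
      using golden_G_coarse \<open>0 < r\<close> by (intro mult_right_mono; simp)+
    then have "q \<le> (2 - golden_G) * r" "q \<le> golden_G * r" "q \<le> r"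
      using that IH by linarith+
    then show ?thesis using \<open>0 < r\<close> IH(1) unfolding pqr by simp
  qed
  show ?case
  using q0
  proof (cases rule: step_cases)
    case pos1
    then have r: "r = q + p" and z: "golden_G - 2 \<le> z (Suc k)" by (simp_all add: p_q_r_def)
    have "0 < r" "q \<le> r" using r IH by auto
    moreover have "1 * r \<le> golden_G * r"
      using \<open>0 < r\<close> golden_G_coarse by (intro mult_right_mono) auto
    ultimately have "0 < r" "q \<le> r" "q \<le> golden_G * r" by linarith+
    then show ?thesis using z IH(1) unfolding pqr by simp
  next
    case neg1
    then have r: "r = q - p" and z: "z k < golden_G - 2" "- 1 / (3 + \<alpha>) \<le> z (Suc k)"
      "golden_G - 2 \<le> z (Suc k)"
      by (simp_all add: p_q_r_def)
    have le: "p \<le> (2 - golden_G) * q" using IH(4) z(1) by fastforce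
    then have r_ge: "(golden_G - 1) * q \<le> r" using r by (simp add: algebra_simps)
    moreover have "0 < (golden_G - 1) * q" using IH(1) golden_G_coarse by simp
    ultimately have "0 < r" by linarith
    have "golden_G * ((golden_G - 1) * q) \<le> golden_G * r"
      using r_ge golden_G_coarse by (intro mult_left_mono) auto
    moreover have "golden_G * ((golden_G - 1) * q) = q"
      using golden_G_square by (simp add: algebra_simps flip: mult.assoc)
    ultimately have "q \<le> golden_G * r" by linarith
    then show ?thesis using \<open>0 < r\<close> z IH(1) unfolding pqr by simp
  next
    case neg3
    then have r: "r = 3 * q - p" and z: "z k < - 1 / (3 + \<alpha>)"
      "golden_G - 2 \<le> z k \<longrightarrow> golden_G - 2 \<le> z (Suc k)"
      by (simp_all add: p_q_r_def)
    have "p \<le> q" using IH(5) z(1) by fastforce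
    then have "0 < r" "q \<le> r" using r IH(1) by auto
    moreover have "1 * r \<le> golden_G * r"
      using \<open>0 < r\<close> golden_G_coarse by (intro mult_right_mono) auto
    ultimately have "0 < r" "q \<le> r" "q \<le> golden_G * r" by linarith+
    \<comment> \<open>If the new point were below - g^2, so would be the old one, by preservation
      under digit 3. Then p <= g^2 q, hence r >= (3 - g^2) q = G^2 q, against the assumed ratio
      above g^2.\<close>
    moreover have "golden_G - 2 \<le> z (Suc k)" if "(2 - golden_G) * r < q"
    proof (rule ccontr)
      assume "\<not> ?thesis"
      then have "p \<le> (2 - golden_G) * q" using IH(4) z(2) by fastforce
      then have "(golden_G + 1) * q \<le> r" using r by (simp add: algebra_simps)
      then have "(2 - golden_G) * ((golden_G + 1) * q) \<le> (2 - golden_G) * r"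
        using golden_G_coarse by (intro mult_left_mono) auto
      moreover have "(2 - golden_G) * ((golden_G + 1) * q) = q"
        using golden_G_square by (simp add: algebra_simps flip: mult.assoc)
      ultimately show False using that by linarith
    qed
    ultimately show ?thesis using IH(1) unfolding pqr by simp
  next
    case pos_ge3
    then have "3 * q \<le> r" using IH(2) unfolding pqr by linarith
    then show ?thesis by (rule small)
  next
    case neg_ge5
    then have "3 * q \<le> r" using IH(1,3) Gq unfolding pqr by linarith
    then show ?thesis by (rule small)
  qed
qed

lemma shift_pos: "0 < h (Suc k)"
  and shift_nonneg: "0 \<le> h k"
  and shift_le_golden_G: "h k \<le> golden_G * h (Suc k)"
  using denominator_invariant[of k] by auto

lemmas step_cases' = step_cases[OF less_imp_le[OF shift_pos],
  case_names pos1 neg1 neg3 pos_ge3 neg_ge5]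

lemma shift_le_if_less_neg_square:
  "z k < golden_G - 2 \<Longrightarrow> h k \<le> (2 - golden_G) * h (Suc k)"
  using denominator_invariant[of k] by fastforce

lemma shift_le_if_less_neg_inverse:
  "z k < - 1 / (3 + \<alpha>) \<Longrightarrow> h k \<le> h (Suc k)"
  using denominator_invariant[of k] by fastforce

lemma shift_le_rational: "h k \<le> 81 / 50 * h (Suc k)"
proof -
  have "golden_G * h (Suc k) \<le> 81 / 50 * h (Suc k)"
    using golden_G_coarse shift_pos[of k] by (intro mult_right_mono) auto
  then show ?thesis using shift_le_golden_G[of k] by linarith
qed

text \<open>Both cases with small digits return the bound on the orbit point, so the split can be
  applied repeatedly.\<close>

lemma step_cases_after_neg_square [consumes 1]:
  assumes "golden_G - 2 \<le> z k"
  obtains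
    (pos1) "h (Suc (Suc k)) = h (Suc k) + h k" "golden_G - 2 \<le> z (Suc k)"
  | (neg3) "h (Suc (Suc k)) = 3 * h (Suc k) - h k" "z k < - 1 / (3 + \<alpha>)"
      "golden_G - 2 \<le> z (Suc k)"
  | (large) "3 * h (Suc k) \<le> h (Suc (Suc k))"
proof (cases rule: step_cases'[of k])
  case neg1
  then show thesis using assms by simp
next
  case neg_ge5
  then show thesis using shift_le_rational[of k] shift_pos[of k] by (intro large) simp
next
  case pos_ge3
  then show thesis using shift_nonneg[of k] by (intro large) simp
qed (use assms that in auto)

section \<open>Growth by a power of B within five steps\<close>

lemma growthI:
  assumes "c * h (Suc k) \<le> h (Suc k + j)" "rate_B ^ j \<le> c" "j \<in> {1..5}"
  shows "\<exists>j\<in>{1..5}. rate_B ^ j * h (Suc k) \<le> h (Suc k + j)"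
proof (rule bexI[OF _ assms(3)])
  have "rate_B ^ j * h (Suc k) \<le> c * h (Suc k)"
    using assms(2) shift_pos[of k] by (intro mult_right_mono) auto
  then show "rate_B ^ j * h (Suc k) \<le> h (Suc k + j)" using assms(1) by linarith
qed

lemma growth_after_pos_digit1:
  assumes "h (Suc (Suc k)) = h (Suc k) + h k" "golden_G - 2 \<le> z (Suc k)"
  shows "\<exists>j\<in>{1..5}. rate_B ^ j * h (Suc k) \<le> h (Suc k + j)"
proof -
  define p q where "p = h k" "q = h (Suc k)"
  have pq: "0 \<le> p" "0 < q" using shift_nonneg shift_pos by (auto simp: p_q_def)
  have j2: ?thesis if "2.06 * q \<le> h (Suc (Suc (Suc k)))"
    using that by (intro growthI[OF _ rate_B_pow_le(1)]) (simp_all add: p_q_def eval_nat_numeral)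
  have j3: ?thesis if "2.96 * q \<le> h (Suc (Suc (Suc (Suc k))))"
    using that by (intro growthI[OF _ rate_B_pow_le(2)]) (simp_all add: p_q_def eval_nat_numeral)
  have h2: "h (Suc (Suc k)) = q + p" using assms by (simp add: p_q_def)
  show ?thesis
    using assms(2)
  proof (cases rule: step_cases_after_neg_square)
    case pos1
    then have h3: "h (Suc (Suc (Suc k))) = 2 * q + p" using h2 by (simp add: p_q_def)
    \<comment> \<open>Two steps may fall short, as 2 < B^2, but every third step reaches at least 3
      q.\<close>
    show ?thesis
      by (rule step_cases_after_neg_square[OF pos1(2)]; rule j3) (use h2 h3 pq in simp_all)
  next
    case neg3
    then have h3: "h (Suc (Suc (Suc k))) = 2 * q + 3 * p" using h2 by (simp add: p_q_def)
    show ?thesis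
      by (rule step_cases_after_neg_square[OF neg3(3)]; rule j3) (use h2 h3 pq in simp_all)
  next
    case large
    then show ?thesis using pq h2 by (intro j2) simp
  qed
qed

text \<open>The next point excludes digits 1 and 3 with sign -1. As long as digits 1 with sign +1
  follow, the denominators are q - p, 2 q - p, 3 q - 2 p, 5 q - 3 p, 8 q - 5 p; any other digit
  gives enough growth earlier, or at the fifth step at least 8 q - 5 p.\<close>

lemma growth_after_neg_digit1:
  assumes h2: "h (Suc (Suc k)) = h (Suc k) - h k"
    and z: "z k < golden_G - 2" "- 1 / (3 + \<alpha>) \<le> z (Suc k)"
  shows "\<exists>j\<in>{1..5}. rate_B ^ j * h (Suc k) \<le> h (Suc k + j)"
proof -
  define p q where "p = h k" "q = h (Suc k)"
  have pq: "0 \<le> p" "0 < q" "p \<le> (2 - golden_G) * q"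
    using shift_nonneg shift_pos shift_le_if_less_neg_square[OF z(1)] by (auto simp: p_q_def)
  have p: "p \<le> 0.382 * q"
  proof -
    have "(2 - golden_G) * q \<le> 0.382 * q"
      using golden_G_bounds pq by (intro mult_right_mono) auto
    then show ?thesis using pq by linarith
  qed
  have j2: ?thesis if "2.06 * q \<le> h (Suc (Suc (Suc k)))"
    using that by (intro growthI[OF _ rate_B_pow_le(1)]) (simp_all add: p_q_def eval_nat_numeral)
  have j3: ?thesis if "2.96 * q \<le> h (Suc (Suc (Suc (Suc k))))"
    using that by (intro growthI[OF _ rate_B_pow_le(2)]) (simp_all add: p_q_def eval_nat_numeral)
  have j4: ?thesis if "4.25 * q \<le> h (Suc (Suc (Suc (Suc (Suc k)))))"
    using that by (intro growthI[OF _ rate_B_pow_le(3)]) (simp_all add: p_q_def eval_nat_numeral)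
  \<comment> \<open>Here the exact bound p <= g^2 q is needed: 8 - 5 g^2 = 5 G - 2 = B^5.\<close>
  have j5: ?thesis if "8 * q - 5 * p \<le> h (Suc (Suc (Suc (Suc (Suc (Suc k))))))"
  proof (rule growthI)
    have "(5 * golden_G - 2) * q \<le> 8 * q - 5 * p"
      using pq(3) by (simp add: algebra_simps)
    also note that
    finally show "(5 * golden_G - 2) * h (Suc k) \<le> h (Suc k + 5)"
      by (simp add: p_q_def eval_nat_numeral)
  qed (simp_all add: rate_B_pow5)
  have h2: "h (Suc (Suc k)) = q - p" using h2 by (simp add: p_q_def)
  show ?thesis
  proof (cases rule: step_cases'[of "Suc k"])
    case pos1
    then have h3: "h (Suc (Suc (Suc k))) = 2 * q - p" using h2 by (simp add: p_q_def)
    show ?thesis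
      using pos1(2)
    proof (cases rule: step_cases_after_neg_square)
      case pos1
      then have h4: "h (Suc (Suc (Suc (Suc k)))) = 3 * q - 2 * p" using h2 h3 by simp
      show ?thesis
        using pos1(2)
      proof (cases rule: step_cases_after_neg_square)
        case pos1
        then have h5: "h (Suc (Suc (Suc (Suc (Suc k))))) = 5 * q - 3 * p" using h3 h4 by simp
        show ?thesis
          by (rule step_cases_after_neg_square[OF pos1(2)]; rule j5) (use h4 h5 p pq in simp_all)
      next
        case neg3
        then show ?thesis using h3 h4 p pq by (intro j4) simp
      next
        case large
        then show ?thesis using h3 h4 p pq by (intro j4) simp
      qed
    next
      case neg3
      then show ?thesis using h2 h3 p pq by (intro j3) simp
    next
      case large
      then show ?thesis using h2 h3 p pq by (intro j3) simp
    qed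
  next
    case neg1
    then show ?thesis using z(2) neg_inverse_ge[OF alpha] by simp
  next
    case neg3
    then show ?thesis using z(2) by simp
  next
    case pos_ge3
    then show ?thesis using h2 p pq by (intro j2) (simp add: p_q_def)
  next
    case neg_ge5
    \<comment> \<open>The tightest rational estimate: 5 (q - p) - q = 4 q - 5 p >= 2.09 q.\<close>
    then show ?thesis using h2 p pq by (intro j2) (simp add: p_q_def)
  qed
qed

text \<open>Apart from digit 1, a single step already at least doubles the denominator, and B <
  2.\<close>

lemma growth:
  "\<exists>j\<in>{1..5}. rate_B ^ j * ocf_q \<alpha> x n \<le> ocf_q \<alpha> x (n + j)"
proof -
  have pos: "0 \<le> h n" "0 < h (Suc n)" by (rule shift_nonneg shift_pos)+
  have j1: "\<exists>j\<in>{1..5}. rate_B ^ j * h (Suc n) \<le> h (Suc n + j)"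
    if "2 * h (Suc n) \<le> h (Suc (Suc n))"
    using that rate_B_bounds by (intro growthI[of 2 n 1]) simp_all
  have "\<exists>j\<in>{1..5}. rate_B ^ j * h (Suc n) \<le> h (Suc n + j)"
  proof (cases rule: step_cases'[of n])
    case pos1
    then show ?thesis by (rule growth_after_pos_digit1)
  next
    case neg1
    then show ?thesis by (intro growth_after_neg_digit1)
  next
    case neg3
    then show ?thesis using shift_le_if_less_neg_inverse[of n] by (intro j1) simp
  next
    case pos_ge3
    then show ?thesis using pos by (intro j1) simp
  next
    case neg_ge5
    then show ?thesis using pos shift_le_rational[of n] by (intro j1) simp
  qed
  then show ?thesis by (simp add: ocf_q_def)
qed

section \<open>The exponential lower bound and the ratio bound\<close>

lemma ocf_q_pos: "0 < ocf_q \<alpha> x n"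
  by (simp add: ocf_q_def shift_pos)

lemma golden_g_pow_mult_le: "golden_g ^ i * ocf_q \<alpha> x n \<le> ocf_q \<alpha> x (n + i)"
proof (induction i)
  case (Suc i)
  have gG: "golden_g * golden_G = 1"
    using golden_G_square by (simp add: golden_g_eq algebra_simps)
  have g: "0 \<le> golden_g" using golden_G_coarse by (simp add: golden_g_eq)
  have "golden_g * ocf_q \<alpha> x (n + i) \<le> golden_g * (golden_G * ocf_q \<alpha> x (Suc (n + i)))"
    using shift_le_golden_G[of "Suc (n + i)"] g
    by (intro mult_left_mono) (simp_all add: ocf_q_def)
  also have "\<dots> = ocf_q \<alpha> x (n + Suc i)" using gG by (simp flip: mult.assoc)
  finally show ?case using mult_left_mono[OF Suc.IH g] by (simp add: mult.assoc)
qed simp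

lemma ocf_q_lower_bound: "const_q * rate_B ^ n \<le> ocf_q \<alpha> x n"
proof -
  have B: "0 < rate_B" using rate_B_bounds by simp
  have g: "0 \<le> golden_g" "golden_g \<le> rate_B"
    using golden_G_coarse rate_B_bounds by (auto simp: golden_g_eq)
  \<comment> \<open>Indices m with q_m >= B^m start at 0 and recur with gaps of at most 5, so one
    lies among the last five indices up to n.\<close>
  have jump: "\<exists>m\<le>n. n \<le> m + 4 \<and> rate_B ^ m \<le> ocf_q \<alpha> x m" for n
  proof (induction n)
    case 0
    show ?case by (simp add: ocf_q_def)
  next
    case (Suc n)
    then obtain m where m: "m \<le> n" "n \<le> m + 4" "rate_B ^ m \<le> ocf_q \<alpha> x m" by auto
    obtain j where j: "j \<in> {1..5}" "rate_B ^ j * ocf_q \<alpha> x m \<le> ocf_q \<alpha> x (m + j)"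
      using growth by blast
    show ?case
    proof (cases "Suc n \<le> m + 4")
      case True
      then show ?thesis using m by (intro exI[of _ m]) auto
    next
      case False
      \<comment> \<open>Now \<open>Suc n = m + 5\<close>, so 1 <= j <= 5 puts \<open>m + j\<close>
        back into the window.\<close>
      have "rate_B ^ (m + j) = rate_B ^ j * rate_B ^ m" by (simp add: power_add)
      also have "\<dots> \<le> rate_B ^ j * ocf_q \<alpha> x m" using m(3) B by (intro mult_left_mono) auto
      also note j(2)
      finally show ?thesis using False m j(1) by (intro exI[of _ "m + j"]) auto
    qed
  qed
  obtain m where m: "m \<le> n" "n \<le> m + 4" "rate_B ^ m \<le> ocf_q \<alpha> x m"
    using jump by blast
  define i where "i = n - m"
  have i: "i \<le> 4" "n = m + i" using m by (auto simp: i_def)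
  \<comment> \<open>Each leftover step costs g / B <= 1, so four steps are the worst case.\<close>
  have "const_q \<le> (golden_g / rate_B) ^ i"
    unfolding const_q_def using g B i by (intro power_decreasing) auto
  then have "const_q * rate_B ^ n \<le> (golden_g / rate_B) ^ i * rate_B ^ n"
    using B by (intro mult_right_mono) auto
  also have "\<dots> = golden_g ^ i * rate_B ^ m"
    using B i by (simp add: power_divide power_add)
  also have "\<dots> \<le> golden_g ^ i * ocf_q \<alpha> x m"
    using m(3) g by (intro mult_left_mono) auto
  also have "\<dots> \<le> ocf_q \<alpha> x n" using golden_g_pow_mult_le i by simp
  finally show ?thesis .
qed

text \<open>As B > 1 and j >= 1, growth by B^j implies growth by B, and 1 / B does not depend on
  j.\<close>

lemma ocf_q_ratio_le:
  "\<exists>j\<in>{1..5}. ocf_q \<alpha> x n / ocf_q \<alpha> x (n + j) \<le> root 5 (1 / (5 * golden_G - 2))"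
proof -
  obtain j where j: "j \<in> {1..5}" "rate_B ^ j * ocf_q \<alpha> x n \<le> ocf_q \<alpha> x (n + j)"
    using growth by blast
  have "rate_B ^ 1 \<le> rate_B ^ j"
    using j(1) rate_B_bounds by (intro power_increasing) auto
  then have "rate_B * ocf_q \<alpha> x n \<le> rate_B ^ j * ocf_q \<alpha> x n"
    using ocf_q_pos[of n] by (intro mult_right_mono) auto
  then have "ocf_q \<alpha> x n / ocf_q \<alpha> x (n + j) \<le> 1 / rate_B"
    using j(2) ocf_q_pos[of "n + j"] rate_B_bounds by (simp add: field_simps)
  also have "\<dots> = root 5 (1 / (5 * golden_G - 2))"
    by (simp add: rate_B_def real_root_divide)
  finally show ?thesis using j(1) by blast
qed

end

theorem proposition8:
  fixes \<alpha> :: real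
  assumes "\<alpha> \<in> {golden_g..golden_G}"
  shows "(\<forall>x \<in> ocf_interval \<alpha>. x \<notin> \<rat> \<longrightarrow> (\<forall>n::nat.
            Min {ocf_q \<alpha> x n / ocf_q \<alpha> x (n + 1),
                 ocf_q \<alpha> x n / ocf_q \<alpha> x (n + 2),
                 ocf_q \<alpha> x n / ocf_q \<alpha> x (n + 3),
                 ocf_q \<alpha> x n / ocf_q \<alpha> x (n + 4),
                 ocf_q \<alpha> x n / ocf_q \<alpha> x (n + 5)}
              \<le> root 5 (1 / (5 * golden_G - 2))
          \<and> ocf_q \<alpha> x n \<ge> const_q * rate_B ^ n))
       \<and> rate_B > sqrt 2
       \<and> \<bar>rate_B - 1.43524\<bar> \<le> 0.000005
       \<and> \<bar>const_q - 0.03438\<bar> \<le> 0.000005"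
proof (intro conjI ballI impI allI)
  fix x n assume "x \<in> ocf_interval \<alpha>" "x \<notin> \<rat>"
  then interpret ocf_expansion \<alpha> x using assms by unfold_locales
  obtain j where "j \<in> {1..5}"
    and j: "ocf_q \<alpha> x n / ocf_q \<alpha> x (n + j) \<le> root 5 (1 / (5 * golden_G - 2))"
    using ocf_q_ratio_le by blast
  then have "j \<in> {1, 2, 3, 4, 5}" by auto
  with j show "Min {ocf_q \<alpha> x n / ocf_q \<alpha> x (n + 1),
                 ocf_q \<alpha> x n / ocf_q \<alpha> x (n + 2),
                 ocf_q \<alpha> x n / ocf_q \<alpha> x (n + 3),
                 ocf_q \<alpha> x n / ocf_q \<alpha> x (n + 4),
                 ocf_q \<alpha> x n / ocf_q \<alpha> x (n + 5)}
              \<le> root 5 (1 / (5 * golden_G - 2))"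
    by (subst Min_le_iff) auto
  show "const_q * rate_B ^ n \<le> ocf_q \<alpha> x n" by (rule ocf_q_lower_bound)
next
  show "sqrt 2 < rate_B" by (rule rate_B_gt_sqrt2)
  show "\<bar>rate_B - 1.43524\<bar> \<le> 0.000005" using rate_B_bounds by (simp add: abs_le_iff)
  show "\<bar>const_q - 0.03438\<bar> \<le> 0.000005" by (rule const_q_approx)
qed

end
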